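(* Let $E$ be a symmetric Banach function space on $\mathbf{R}^+=[0,\infty)$. If $E$ has the uniform Kadec-Klee-Huff property with respect to local convergence in measure, then $E$ satisfies a lower $q$-estimate for some finite $q$.
   Context: For a measurable function $f$ on $\mathbf{R}^+$, $\mu(f)$ denotes the right-continuous decreasing rearrangement of $|f|$ with respect to Lebesgue measure: $\mu_t(f)=\inf\{s\ge 0:|\{|f|>s\}|\le t\}$. A symmetric Banach function space on $\mathbf{R}^+$ is a Banach lattice $E$ of (complex) Lebesgue measurable functions on $\mathbf{R}^+$ such that (i) $E$ is an order ideal in the space $L^0(\mathbf{R}^+)$ of all finite a.e. measurable functions; (ii) if $x\in E$ and $y$ is measurable with $\mu(y)=\mu(x)$, then $y\in E$ and $\|y\|_E=\|x\|_E$; (iii) $E$ contains all finitely supported simple functions (those with support of finite measure). $E$ satisfies a lower $q$-estimate if there is a constant $C>0$ such that $(\sum\|x_n\|_E^q)^{1/q}\le C\|\sum x_n\|_E$ for all finite sequences $(x_n)$ of mutually disjoint elements of $E$. Local convergence in measure in $E$ means convergence in measure on every measurable subset of $\mathbf{R}^+$ of finite Lebesgue measure. $E$ has the uniform Kadec-Klee-Huff property with respect to local convergence in measure if for every $\epsilon>0$ there exists $\delta\in(0,1)$ such that whenever $(x_n)$ is a sequence in the closed unit ball of $E$ with $x_n\to x\in E$ locally in measure and $\|x\|_E>1-\delta$, there is a positive integer $N$ with $\sup_{n,m\ge N}\|x_n-x_m\|_E\le\epsilon$. *)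

theory Defs
  imports "HOL-Analysis.Analysis"
begin

abbreviation half_line :: "real measure" where
  "half_line \<equiv> lebesgue_on {0..}"

text \<open>
  The value is \<open>\<infinity>\<close> (the infimum of the empty set) if \<open>\<bar>f\<bar>\<close> exceeds every \<open>s\<close> on a set of
  measure greater than \<open>t\<close>.
\<close>

definition rearrangement :: "(real \<Rightarrow> complex) \<Rightarrow> real \<Rightarrow> ennreal" where
  "rearrangement f t =
     (INF s\<in>{s. 0 \<le> s \<and> emeasure half_line {u \<in> space half_line. cmod (f u) > s} \<le> ennreal t}.
        ennreal s)"

text \<open>
  A space of (classes of) measurable functions is given by its carrier \<open>E\<close>, a set of functions,
  and a function \<open>N\<close> whose restriction to \<open>E\<close> is the norm. Functions that agree almost everywhere on
  the half-line represent the same element: by \<open>order_ideal\<close> and \<open>norm_mono\<close>, both \<open>E\<close> and \<open>N\<close> are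
  invariant under almost everywhere equality, and values at negative arguments are irrelevant.
  Finiteness almost everywhere is built into the type of the functions. Nonnegativity of \<open>N\<close> on
  \<open>E\<close> follows from \<open>norm_mono\<close> and \<open>norm_eq_zero\<close>.
\<close>

locale symmetric_Banach_function_space =
  fixes E :: "(real \<Rightarrow> complex) set"
    and N :: "(real \<Rightarrow> complex) \<Rightarrow> real"
  assumes measurable: "x \<in> E \<Longrightarrow> x \<in> borel_measurable half_line"
    and add_closed: "x \<in> E \<Longrightarrow> y \<in> E \<Longrightarrow> (\<lambda>u. x u + y u) \<in> E"
    and scale_closed: "x \<in> E \<Longrightarrow> (\<lambda>u. c * x u) \<in> E"
    and norm_eq_zero: "x \<in> E \<Longrightarrow> N x = 0 \<longleftrightarrow> (AE u in half_line. x u = 0)"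
    and norm_triangle: "x \<in> E \<Longrightarrow> y \<in> E \<Longrightarrow> N (\<lambda>u. x u + y u) \<le> N x + N y"
    and norm_scale: "x \<in> E \<Longrightarrow> N (\<lambda>u. c * x u) = cmod c * N x"
    and norm_mono: "x \<in> E \<Longrightarrow> y \<in> E \<Longrightarrow> (AE u in half_line. cmod (x u) \<le> cmod (y u)) \<Longrightarrow> N x \<le> N y"
    and complete:
      "(\<And>n. X n \<in> E) \<Longrightarrow>
       (\<And>e. e > 0 \<Longrightarrow> \<exists>K. \<forall>m\<ge>K. \<forall>n\<ge>K. N (\<lambda>u. X m u - X n u) < e) \<Longrightarrow>
       \<exists>x\<in>E. (\<lambda>n::nat. N (\<lambda>u. X n u - x u)) \<longlonglongrightarrow> 0"
    and order_ideal:
      "y \<in> E \<Longrightarrow> x \<in> borel_measurable half_line \<Longrightarrow>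
       (AE u in half_line. cmod (x u) \<le> cmod (y u)) \<Longrightarrow> x \<in> E"
    and symmetric:
      "x \<in> E \<Longrightarrow> y \<in> borel_measurable half_line \<Longrightarrow>
       (\<forall>t\<ge>0. rearrangement y t = rearrangement x t) \<Longrightarrow> y \<in> E \<and> N y = N x"
    and simple_mem:
      "simple_function half_line f \<Longrightarrow>
       emeasure half_line {u \<in> space half_line. f u \<noteq> 0} < \<infinity> \<Longrightarrow> f \<in> E"

definition lower_estimate ::
  "(real \<Rightarrow> complex) set \<Rightarrow> ((real \<Rightarrow> complex) \<Rightarrow> real) \<Rightarrow> real \<Rightarrow> bool" where
  "lower_estimate E N q \<longleftrightarrow>
     (\<exists>C>0. \<forall>(n::nat) x.
        (\<forall>i<n. x i \<in> E) \<and>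
        (\<forall>i<n. \<forall>j<n. i \<noteq> j \<longrightarrow> (AE u in half_line. x i u = 0 \<or> x j u = 0)) \<longrightarrow>
        (\<Sum>i<n. N (x i) powr q) powr (1 / q) \<le> C * N (\<lambda>u. \<Sum>i<n. x i u))"

definition locally_tendsto_in_measure ::
  "(nat \<Rightarrow> real \<Rightarrow> complex) \<Rightarrow> (real \<Rightarrow> complex) \<Rightarrow> bool" where
  "locally_tendsto_in_measure X x \<longleftrightarrow>
     (\<forall>A\<in>sets half_line. emeasure half_line A < \<infinity> \<longrightarrow>
        (\<forall>e>0. (\<lambda>n. emeasure half_line {u \<in> A. cmod (X n u - x u) > e}) \<longlonglongrightarrow> 0))"

definition uniform_Kadec_Klee_Huff ::
  "(real \<Rightarrow> complex) set \<Rightarrow> ((real \<Rightarrow> complex) \<Rightarrow> real) \<Rightarrow> bool" where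
  "uniform_Kadec_Klee_Huff E N \<longleftrightarrow>
     (\<forall>\<epsilon>>0. \<exists>\<delta>. 0 < \<delta> \<and> \<delta> < 1 \<and>
        (\<forall>X x. (\<forall>n. X n \<in> E \<and> N (X n) \<le> 1) \<and> x \<in> E \<and>
           locally_tendsto_in_measure X x \<and> N x > 1 - \<delta> \<longrightarrow>
           (\<exists>K. \<forall>m\<ge>K. \<forall>n\<ge>K. N (\<lambda>u. X n u - X m u) \<le> \<epsilon>)))"

end

theory Submission
  imports Defs
begin

text \<open>
  Let \<open>x\<close> and \<open>y\<close> be disjoint with bounded supports. The functions \<open>x + y\<^sub>n\<close>, where the \<open>y\<^sub>n\<close> are
  disjoint translates of \<open>y\<close> moving off to infinity, are all equimeasurable with \<open>x + y\<close> and
  converge to \<open>x\<close> locally in measure, but their mutual distances are at least the norm of \<open>y\<close>.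
  Hence, if \<open>\<delta>\<close> belongs to \<open>\<epsilon> = 1/2\<close>, then \<open>y\<close> having more than half the norm of \<open>x + y\<close> forces
  \<open>x\<close> to have at most \<open>1 - \<delta>\<close> times that norm.

  Given finitely many disjoint \<open>x\<^sub>i\<close> with sum \<open>s\<close>, choose a maximal subfamily whose sum has at most
  half the norm of \<open>s\<close>. Adding one more \<open>x\<^sub>k\<close> crosses one half, so the sum of the remaining ones has
  at most \<open>1 - \<delta>\<close> times the norm of \<open>s\<close>. For \<open>q\<close> with \<open>(1/2)^q + (1 - \<delta>)^q \<le> 1/2\<close>, induction on
  the two parts shows that the sum of the \<open>q\<close>-th powers of the norms of the \<open>x\<^sub>i\<close> is at most twice
  the \<open>q\<close>-th power of the norm of \<open>s\<close>. Unbounded supports are reached by truncation, which is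
  norm continuous by the Kadec-Klee property and completeness.
\<close>

section \<open>A splitting inequality for set functions\<close>

text \<open>In the application \<open>F A\<close> is the norm of the sum over \<open>A\<close>. When
  \<open>J\<close> is cut into \<open>A\<close>, a single \<open>k\<close> and \<open>B\<close>, the
  point \<open>k\<close> costs at most \<open>F J ^ q\<close>, and the induction hypothesis on
  \<open>A\<close> and \<open>B\<close> adds at most
  \<open>2 * ((1 / 2) ^ q + r ^ q) \<le> 1\<close> times \<open>F J ^ q\<close>. So the constant 2
  reproduces itself.\<close>

lemma sum_power_le_of_split:
  fixes F :: "'a set \<Rightarrow> real"
  assumes "finite I" and "F {} = 0"
    and mono: "\<And>A B. A \<subseteq> B \<Longrightarrow> B \<subseteq> I \<Longrightarrow> F A \<le> F B"
    and split: "\<And>A B. A \<union> B \<subseteq> I \<Longrightarrow> A \<inter> B = {} \<Longrightarrow> F (A \<union> B) < 2 * F A \<Longrightarrow> F B \<le> r * F (A \<union> B)"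
    and q: "0 < q" "(1 / 2) ^ q + r ^ q \<le> 1 / 2"
  shows "(\<Sum>i\<in>I. F {i} ^ q) \<le> 2 * F I ^ q"
proof -
  have nonneg: "0 \<le> F A" if "A \<subseteq> I" for A
    using mono[of "{}" A] that \<open>F {} = 0\<close> by simp
  have "finite J \<Longrightarrow> J \<subseteq> I \<Longrightarrow> (\<Sum>i\<in>J. F {i} ^ q) \<le> 2 * F J ^ q" for J
  proof (induction J rule: finite_psubset_induct)
    case (psubset J)
    show ?case
    proof (cases "F J = 0")
      \<comment> \<open>This case is separated because for \<open>F J = 0\<close> the maximal
        \<open>A\<close> below could be all of \<open>J\<close>, leaving no \<open>k\<close> to
        add.\<close>
      case True
      have "F {i} = 0" if "i \<in> J" for i
        using mono[of "{i}" J] nonneg[of "{i}"] psubset.prems that True by force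
      then show ?thesis
        using q(1) True by (simp add: power_0_left)
    next
      case False
      then have pos: "0 < F J"
        using nonneg[OF psubset.prems] by simp
      let ?P = "{A. A \<subseteq> J \<and> 2 * F A \<le> F J}"
      have P: "finite ?P" "?P \<noteq> {}"
        using psubset.hyps pos \<open>F {} = 0\<close> by (auto intro!: exI[of _ "{}"])
      obtain A where A: "A \<in> ?P" and A_max: "\<forall>B\<in>?P. A \<subseteq> B \<longrightarrow> A = B"
        using finite_has_maximal[OF P] by blast
      have "A \<noteq> J"
        using A pos by auto
      then obtain k where k: "k \<in> J" "k \<notin> A"
        using A by auto
      define B where "B = J - insert k A"
      have J: "J = insert k A \<union> B" "insert k A \<inter> B = {}"
        using A k by (auto simp: B_def)
      have "insert k A \<notin> ?P"
        using A_max k(2) by blast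
      then have "F J < 2 * F (insert k A)"
        using A k by auto
      then have FB: "F B \<le> r * F J"
        using split[of "insert k A" B] J psubset.prems by auto
      have subs: "A \<subset> J" "B \<subset> J" "A \<subseteq> I" "B \<subseteq> I"
        using A k psubset.prems by (auto simp: B_def)
      have "(\<Sum>i\<in>J. F {i} ^ q) = (\<Sum>i\<in>insert k A. F {i} ^ q) + (\<Sum>i\<in>B. F {i} ^ q)"
        using J psubset.hyps by (metis finite_Un sum.union_disjoint)
      also have "\<dots> = F {k} ^ q + (\<Sum>i\<in>A. F {i} ^ q) + (\<Sum>i\<in>B. F {i} ^ q)"
        using k finite_subset[OF psubset_imp_subset[OF subs(1)] psubset.hyps] by simp
      also have "\<dots> \<le> F {k} ^ q + 2 * F A ^ q + 2 * F B ^ q"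
        using psubset.IH[OF subs(1,3)] psubset.IH[OF subs(2,4)] by simp
      \<comment> \<open>Monotonicity bounds the term of \<open>k\<close>, the choice of
        \<open>A\<close> gives the factor 1/2, and \<open>FB\<close> gives the factor
        \<open>r\<close>.\<close>
      also have "\<dots> \<le> F J ^ q + 2 * (1 / 2 * F J) ^ q + 2 * (r * F J) ^ q"
        using mono[of "{k}" J] nonneg[of "{k}"] nonneg[of A] nonneg[of B] A FB k subs psubset.prems
        by (intro add_mono mult_left_mono power_mono) auto
      also have "\<dots> = F J ^ q + 2 * ((1 / 2) ^ q + r ^ q) * F J ^ q"
        unfolding power_mult_distrib by (simp add: algebra_simps)
      also have "\<dots> \<le> F J ^ q + 2 * (1 / 2) * F J ^ q"
        using q pos by (intro add_left_mono mult_right_mono mult_left_mono) auto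
      finally show ?thesis
        by simp
    qed
  qed
  then show ?thesis
    using \<open>finite I\<close> by simp
qed

section \<open>Level sets, rearrangements and translations\<close>

abbreviation level_measure :: "(real \<Rightarrow> complex) \<Rightarrow> real \<Rightarrow> ennreal" where
  "level_measure f s \<equiv> emeasure half_line {u \<in> space half_line. cmod (f u) > s}"

text \<open>The axiom \<open>symmetric\<close> speaks of rearrangements, whereas disjoint sums and
  translations are controlled through level sets; this passes from the latter to the former.\<close>

lemma rearrangement_cong:
  assumes "\<And>s. 0 \<le> s \<Longrightarrow> level_measure f s = level_measure g s"
  shows "rearrangement f t = rearrangement g t"
proof -
  have "{s. 0 \<le> s \<and> level_measure f s \<le> ennreal t} = {s. 0 \<le> s \<and> level_measure g s \<le> ennreal t}"
    using assms by auto
  then show ?thesis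
    unfolding rearrangement_def by simp
qed

text \<open>At a level \<open>s \<ge> 0\<close> a zero value never counts, so disjoint functions
  have disjoint level sets, and their union is the level set of the sum.\<close>

lemma level_measure_add:
  assumes [measurable]: "f \<in> borel_measurable half_line" "g \<in> borel_measurable half_line"
    and "\<And>u. 0 \<le> u \<Longrightarrow> f u = 0 \<or> g u = 0" and "0 \<le> s"
  shows "level_measure (\<lambda>u. f u + g u) s = level_measure f s + level_measure g s"
proof -
  have sets: "{u \<in> space half_line. cmod (f u) > s} \<in> sets half_line"
    "{u \<in> space half_line. cmod (g u) > s} \<in> sets half_line"
    by measurable
  have "level_measure f s + level_measure g s
      = emeasure half_line ({u \<in> space half_line. cmod (f u) > s} \<union> {u \<in> space half_line. cmod (g u) > s})"
    using assms(3,4) by (intro plus_emeasure sets) fastforce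
  also have "{u \<in> space half_line. cmod (f u) > s} \<union> {u \<in> space half_line. cmod (g u) > s}
      = {u \<in> space half_line. cmod (f u + g u) > s}"
    using assms(3,4) by fastforce
  finally show ?thesis
    by simp
qed

definition shift :: "real \<Rightarrow> (real \<Rightarrow> complex) \<Rightarrow> real \<Rightarrow> complex" where
  "shift a f u = f (u - a)"

text \<open>Lebesgue measure is translation invariant. Vanishing on the negative numbers ensures
  that \<open>shift\<close> moves no stray values into the interval from 0 to
  \<open>a\<close>.\<close>

lemma
  assumes f: "f \<in> borel_measurable half_line" and supp: "\<And>u. u < 0 \<Longrightarrow> f u = 0" and "0 \<le> a"
  shows measurable_shift: "shift a f \<in> borel_measurable half_line"
    and level_measure_shift: "0 \<le> s \<Longrightarrow> level_measure (shift a f) s = level_measure f s"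
proof -
  \<comment> \<open>Being its own extension by zero, \<open>f\<close> is measurable on the whole
    line, where translations are measurable maps.\<close>
  have "(\<lambda>u. if u \<in> {0..} then f u else 0) = f"
    using supp by (auto simp: not_le)
  then have f': "f \<in> borel_measurable lebesgue"
    using borel_measurable_if[of "{0..}" f] f by simp
  have "(\<lambda>u. u - a) \<in> lebesgue \<rightarrow>\<^sub>M lebesgue"
    using lebesgue_affine_measurable[of "\<lambda>_. 1" "- a"] by (simp add: algebra_simps)
  then have "(\<lambda>u. f (u - a)) \<in> borel_measurable lebesgue"
    using f' measurable_compose by blast
  then show m: "shift a f \<in> borel_measurable half_line"
    unfolding shift_def[abs_def] by (rule measurable_restrict_space1)
  assume "0 \<le> s"
  let ?S = "{u \<in> space half_line. cmod (f u) > s}"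
  have "{u \<in> space half_line. cmod (shift a f u) > s} = (+) a ` ?S"
  proof -
    have "u \<in> (+) a ` ?S" if "cmod (shift a f u) > s" for u
      using that supp[of "u - a"] \<open>0 \<le> s\<close>
      by (intro image_eqI[of _ _ "u - a"]) (auto simp: shift_def not_less[symmetric])
    then show ?thesis
      using \<open>0 \<le> a\<close> by (auto simp: shift_def)
  qed
  moreover have "emeasure half_line ((+) a ` ?S) = emeasure lebesgue ((+) a ` ?S)"
    "emeasure half_line ?S = emeasure lebesgue ?S"
    using \<open>0 \<le> a\<close> by (auto intro!: emeasure_restrict_space)
  moreover have "emeasure lebesgue ((+) a ` ?S) = emeasure lebesgue ?S"
    using emeasure_lebesgue_affine[of 1 a ?S] by (simp add: add.commute)
  ultimately show "level_measure (shift a f) s = level_measure f s"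
    by simp
qed

section \<open>Local convergence in measure, truncation and the modulus\<close>

text \<open>Inside a set \<open>A\<close> of finite measure the functions differ only on the part of
  \<open>A\<close> to the right of \<open>n\<close>, and its measure tends to 0 by continuity from
  above. This serves both for truncations and for translates moving to infinity.\<close>

lemma locally_tendsto_in_measureI:
  assumes "\<And>n u. 0 \<le> u \<Longrightarrow> u < real n \<Longrightarrow> X n u = x u"
  shows "locally_tendsto_in_measure X x"
  unfolding locally_tendsto_in_measure_def
proof (intro ballI impI allI)
  fix A and e :: real
  assume A: "A \<in> sets half_line" "emeasure half_line A < \<infinity>" and "0 < e"
  define B where "B n = A \<inter> {real n..}" for n
  have A_sub: "A \<subseteq> {0..}"
    using sets.sets_into_space[OF A(1)] by simp
  have B: "B n \<in> sets half_line" for n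
  proof -
    have "{real n..} \<in> sets half_line"
      by (auto simp: sets_restrict_space_iff)
    then show ?thesis
      using A(1) unfolding B_def by (intro sets.Int)
  qed
  have "(\<lambda>n. emeasure half_line (B n)) \<longlonglongrightarrow> emeasure half_line (\<Inter>n. B n)"
  proof (rule Lim_emeasure_decseq)
    show "decseq B"
      by (auto simp: decseq_def B_def)
    have "emeasure half_line (B n) \<le> emeasure half_line A" for n
      using A(1) by (intro emeasure_mono) (auto simp: B_def)
    then show "emeasure half_line (B n) \<noteq> \<infinity>" for n
      using A(2) le_less_trans less_imp_neq unfolding infinity_ennreal_def by blast
  qed (use B in auto)
  moreover have "(\<Inter>n. B n) = {}"
  proof -
    have "u \<notin> (\<Inter>n. B n)" for u
      using reals_Archimedean2[of u] by (auto simp: B_def not_le)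
    then show ?thesis
      by blast
  qed
  ultimately have lim: "(\<lambda>n. emeasure half_line (B n)) \<longlonglongrightarrow> 0"
    by simp
  show "(\<lambda>n. emeasure half_line {u \<in> A. cmod (X n u - x u) > e}) \<longlonglongrightarrow> 0"
  proof (rule tendsto_sandwich[OF _ _ tendsto_const lim])
    have "{u \<in> A. cmod (X n u - x u) > e} \<subseteq> B n" for n
    proof
      fix u
      assume "u \<in> {u \<in> A. cmod (X n u - x u) > e}"
      then show "u \<in> B n"
        using assms[of u n] A_sub \<open>0 < e\<close> by (cases "u < real n") (auto simp: B_def)
    qed
    then show "\<forall>\<^sub>F n in sequentially. emeasure half_line {u \<in> A. cmod (X n u - x u) > e} \<le> emeasure half_line (B n)"
      using B by (intro always_eventually allI emeasure_mono)
  qed simp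
qed

definition trunc :: "real \<Rightarrow> (real \<Rightarrow> complex) \<Rightarrow> real \<Rightarrow> complex" where
  "trunc k x u = (if u \<in> {0..<k} then x u else 0)"

text \<open>The inner condition of \<open>uniform_Kadec_Klee_Huff\<close> for one fixed pair,
  isolated so that a single \<open>\<delta>\<close> can be carried through several lemmas.\<close>

definition Kadec_Klee_modulus ::
  "(real \<Rightarrow> complex) set \<Rightarrow> ((real \<Rightarrow> complex) \<Rightarrow> real) \<Rightarrow> real \<Rightarrow> real \<Rightarrow> bool" where
  "Kadec_Klee_modulus E N \<epsilon> \<delta> \<longleftrightarrow>
     (\<forall>X x. (\<forall>n. X n \<in> E \<and> N (X n) \<le> 1) \<and> x \<in> E \<and>
        locally_tendsto_in_measure X x \<and> N x > 1 - \<delta> \<longrightarrow>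
        (\<exists>K. \<forall>m\<ge>K. \<forall>n\<ge>K. N (\<lambda>u. X n u - X m u) \<le> \<epsilon>))"

lemma Kadec_Klee_modulusD:
  assumes "Kadec_Klee_modulus E N \<epsilon> \<delta>" "\<And>n. X n \<in> E" "\<And>n. N (X n) \<le> 1" "x \<in> E"
    and "locally_tendsto_in_measure X x" "1 - \<delta> < N x"
  shows "\<exists>K. \<forall>m\<ge>K. \<forall>n\<ge>K. N (\<lambda>u. X n u - X m u) \<le> \<epsilon>"
  using assms(1) unfolding Kadec_Klee_modulus_def
  by (elim allE[of _ X] allE[of _ x] mp) (use assms in simp)

lemma uniform_Kadec_Klee_HuffD:
  assumes "uniform_Kadec_Klee_Huff E N" "0 < \<epsilon>"
  shows "\<exists>\<delta>. 0 < \<delta> \<and> \<delta> < 1 \<and> Kadec_Klee_modulus E N \<epsilon> \<delta>"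
  using assms unfolding uniform_Kadec_Klee_Huff_def Kadec_Klee_modulus_def[symmetric] by simp

section \<open>Elementary lattice facts\<close>

context symmetric_Banach_function_space
begin

lemma zero_mem: "(\<lambda>u. 0) \<in> E"
  by (rule simple_mem) auto

lemma norm_of_zero: "N (\<lambda>u. 0) = 0"
  using norm_eq_zero[OF zero_mem] by simp

lemma norm_nonneg: "x \<in> E \<Longrightarrow> 0 \<le> N x"
  using norm_mono[OF zero_mem, of x] norm_of_zero by simp

lemma norm_cong_AE: "x \<in> E \<Longrightarrow> y \<in> E \<Longrightarrow> (AE u in half_line. x u = y u) \<Longrightarrow> N x = N y"
  by (intro antisym norm_mono) (auto elim: eventually_mono)

lemma diff_closed: "x \<in> E \<Longrightarrow> y \<in> E \<Longrightarrow> (\<lambda>u. x u - y u) \<in> E"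
  using add_closed[of x "\<lambda>u. - 1 * y u"] scale_closed[of y "- 1"] by simp

lemma sum_closed: "finite A \<Longrightarrow> (\<And>i. i \<in> A \<Longrightarrow> x i \<in> E) \<Longrightarrow> (\<lambda>u. \<Sum>i\<in>A. x i u) \<in> E"
  by (induction A rule: finite_induct) (auto intro: zero_mem add_closed)

lemma measurable_trunc: "x \<in> borel_measurable half_line \<Longrightarrow> trunc k x \<in> borel_measurable half_line"
proof -
  assume [measurable]: "x \<in> borel_measurable half_line"
  have [measurable]: "{0..<k} \<in> sets half_line"
    by (auto simp: sets_restrict_space_iff)
  show ?thesis
    unfolding trunc_def[abs_def] by measurable
qed

lemma trunc_closed: "x \<in> E \<Longrightarrow> trunc k x \<in> E"
  by (rule order_ideal[of x]) (auto simp: trunc_def intro: measurable_trunc[OF measurable])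

lemma norm_trunc_le: "x \<in> E \<Longrightarrow> N (trunc k x) \<le> N x"
  by (rule norm_mono) (auto simp: trunc_def intro: trunc_closed)

text \<open>Almost everywhere at most one \<open>x i u\<close> is nonzero, so the smaller sum is
  either 0 or equal to the larger one.\<close>

lemma norm_sum_mono:
  assumes "A \<subseteq> B" "finite B" "\<And>i. i \<in> B \<Longrightarrow> x i \<in> E"
    and disj: "\<And>i j. i \<in> B \<Longrightarrow> j \<in> B \<Longrightarrow> i \<noteq> j \<Longrightarrow> AE u in half_line. x i u = 0 \<or> x j u = 0"
  shows "N (\<lambda>u. \<Sum>i\<in>A. x i u) \<le> N (\<lambda>u. \<Sum>i\<in>B. x i u)"
proof (rule norm_mono)
  have "AE u in half_line. \<forall>i\<in>B. \<forall>j\<in>B. i \<noteq> j \<longrightarrow> x i u = 0 \<or> x j u = 0"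
    using \<open>finite B\<close> disj by (intro AE_finite_allI) auto
  then show "AE u in half_line. cmod (\<Sum>i\<in>A. x i u) \<le> cmod (\<Sum>i\<in>B. x i u)"
  proof (rule AE_mp, intro AE_I2 impI)
    fix u
    assume u: "\<forall>i\<in>B. \<forall>j\<in>B. i \<noteq> j \<longrightarrow> x i u = 0 \<or> x j u = 0"
    have fin: "finite A"
      using assms(1,2) by (rule finite_subset)
    show "cmod (\<Sum>i\<in>A. x i u) \<le> cmod (\<Sum>i\<in>B. x i u)"
    proof (cases "\<exists>k\<in>A. x k u \<noteq> 0")
      case True
      then obtain k where k: "k \<in> A" "x k u \<noteq> 0"
        by auto
      then have "x i u = 0" if "i \<in> B - {k}" for i
        using u that \<open>A \<subseteq> B\<close> by auto
      then have "(\<Sum>i\<in>B. x i u) = x k u" "(\<Sum>i\<in>A. x i u) = x k u"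
        using sum.mono_neutral_right[of B "{k}" "\<lambda>i. x i u"] sum.mono_neutral_right[of A "{k}" "\<lambda>i. x i u"]
          k \<open>A \<subseteq> B\<close> \<open>finite B\<close> fin by auto
      then show ?thesis
        by simp
    qed simp
  qed
qed (use assms(1-3) finite_subset[OF assms(1,2)] in \<open>auto intro!: sum_closed\<close>)

lemma AE_zero_if_trunc:
  assumes "\<And>n::nat. AE u in half_line. trunc (real n) x u = 0"
  shows "AE u in half_line. x u = 0"
proof -
  have "AE u in half_line. \<forall>n::nat. trunc (real n) x u = 0"
    using assms by (simp add: AE_all_countable)
  then show ?thesis
  proof (rule AE_mp, intro AE_I2 impI)
    fix u
    assume "u \<in> space half_line" and u: "\<forall>n::nat. trunc (real n) x u = 0"
    then show "x u = 0"
      using reals_Archimedean2[of u] by (auto simp: trunc_def split: if_splits)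
  qed
qed

section \<open>Norm continuity of truncation\<close>

text \<open>Truncations of a normalised \<open>x\<close> stay in the unit ball and converge to it
  locally in measure, so the Kadec-Klee property makes them Cauchy. Completeness gives a norm limit,
  which must agree with the normalised \<open>x\<close> almost everywhere.\<close>

lemma norm_trunc_tendsto:
  assumes "uniform_Kadec_Klee_Huff E N" and "x \<in> E"
  shows "(\<lambda>n. N (trunc (real n) x)) \<longlonglongrightarrow> N x"
proof (cases "N x = 0")
  case True
  have "N (trunc (real n) x) = 0" for n
    using norm_trunc_le[OF \<open>x \<in> E\<close>, of n] norm_nonneg[OF trunc_closed[OF \<open>x \<in> E\<close>], of n] True by simp
  then show ?thesis
    using True by simp
next
  case False
  then have pos: "0 < N x"
    using norm_nonneg[OF \<open>x \<in> E\<close>] by simp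
  \<comment> \<open>Normalisation places the truncations in the unit ball and makes the norm of
    their local limit 1, above every \<open>1 - \<delta>\<close>.\<close>
  define c where "c = complex_of_real (1 / N x)"
  define X where "X n = trunc (real n) (\<lambda>u. c * x u)" for n
  have cx: "(\<lambda>u. c * x u) \<in> E" "N (\<lambda>u. c * x u) = 1"
    using scale_closed[OF \<open>x \<in> E\<close>, of c] norm_scale[OF \<open>x \<in> E\<close>, of c] pos
    by (auto simp: c_def norm_divide)
  have X: "X n \<in> E" "N (X n) \<le> 1" for n
    using trunc_closed[OF cx(1)] norm_trunc_le[OF cx(1)] cx(2) by (auto simp: X_def)
  have "\<exists>K. \<forall>m\<ge>K. \<forall>n\<ge>K. N (\<lambda>u. X m u - X n u) < e" if "0 < e" for e
  proof -
    \<comment> \<open>Half of \<open>e\<close> is used because the modulus gives a weak inequality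
      and \<open>complete\<close> asks for a strict one.\<close>
    obtain \<delta> where \<delta>: "0 < \<delta>" "Kadec_Klee_modulus E N (e / 2) \<delta>"
      using uniform_Kadec_Klee_HuffD[OF assms(1) half_gt_zero[OF \<open>0 < e\<close>]] by blast
    have "locally_tendsto_in_measure X (\<lambda>u. c * x u)"
      by (rule locally_tendsto_in_measureI) (simp add: X_def trunc_def)
    then obtain K where K: "\<forall>m\<ge>K. \<forall>n\<ge>K. N (\<lambda>u. X n u - X m u) \<le> e / 2"
      using Kadec_Klee_modulusD[OF \<delta>(2) X cx(1)] \<delta>(1) cx(2) by fastforce
    have "N (\<lambda>u. X m u - X n u) < e" if "K \<le> m" "K \<le> n" for m n
      using K[rule_format, OF that(2,1)] \<open>0 < e\<close> by simp
    then show ?thesis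
      by blast
  qed
  then obtain z where z: "z \<in> E" "(\<lambda>n. N (\<lambda>u. X n u - z u)) \<longlonglongrightarrow> 0"
    using complete[of X] X(1) by blast
  define w where "w u = c * x u - z u" for u
  have w: "w \<in> E"
    unfolding w_def[abs_def] by (rule diff_closed[OF cx(1) z(1)])
  \<comment> \<open>For \<open>n \<ge> k\<close> the function \<open>X n\<close> equals
    \<open>c * x\<close> before \<open>k\<close>, so the truncation of \<open>w\<close> is dominated
    by \<open>X n - z\<close>, whose norm tends to 0.\<close>
  have "AE u in half_line. trunc (real k) w u = 0" for k
  proof -
    have "N (trunc (real k) w) \<le> N (\<lambda>u. X n u - z u)" if "k \<le> n" for n
      using w diff_closed[OF X(1) z(1)] that
      by (intro norm_mono trunc_closed) (auto simp: trunc_def X_def w_def)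
    then have "N (trunc (real k) w) \<le> 0"
      using z(2) by (intro LIMSEQ_le_const) auto
    then show ?thesis
      using norm_eq_zero[OF trunc_closed[OF w]] norm_nonneg[OF trunc_closed[OF w]]
      by (metis antisym)
  qed
  then have w0: "AE u in half_line. w u = 0"
    by (rule AE_zero_if_trunc)
  have "N (\<lambda>u. c * x u) \<le> N (X n) + N (\<lambda>u. X n u - z u)" for n
  proof -
    have d: "(\<lambda>u. c * x u - X n u) \<in> E"
      by (rule diff_closed[OF cx(1) X(1)])
    \<comment> \<open>Since \<open>z\<close> equals \<open>c * x\<close> almost everywhere, the two
      differences have the same modulus there.\<close>
    have "N (\<lambda>u. c * x u - X n u) \<le> N (\<lambda>u. X n u - z u)"
      by (rule norm_mono[OF d diff_closed[OF X(1) z(1)]])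
        (use w0 in \<open>auto elim!: eventually_mono simp: w_def norm_minus_commute\<close>)
    then show ?thesis
      using norm_triangle[OF X(1) d, of n] by simp
  qed
  then have lower: "N (\<lambda>u. c * x u) - N (\<lambda>u. X n u - z u) \<le> N (X n)" for n
    by (simp add: diff_le_eq)
  have "(\<lambda>n. N (X n)) \<longlonglongrightarrow> N (\<lambda>u. c * x u)"
  proof (rule tendsto_sandwich[OF _ _ _ tendsto_const])
    show "(\<lambda>n. N (\<lambda>u. c * x u) - N (\<lambda>u. X n u - z u)) \<longlonglongrightarrow> N (\<lambda>u. c * x u)"
      using tendsto_diff[OF tendsto_const z(2)] by simp
    show "\<forall>\<^sub>F n in sequentially. N (\<lambda>u. c * x u) - N (\<lambda>u. X n u - z u) \<le> N (X n)"
      using lower by (intro always_eventually allI)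
    show "\<forall>\<^sub>F n in sequentially. N (X n) \<le> N (\<lambda>u. c * x u)"
      unfolding X_def by (intro always_eventually allI norm_trunc_le[OF cx(1)])
  qed
  moreover have "N (X n) = N (trunc (real n) x) / N x" for n
  proof -
    have "X n = (\<lambda>u. c * trunc (real n) x u)"
      by (auto simp: X_def trunc_def)
    then show ?thesis
      using pos norm_scale[OF trunc_closed[OF \<open>x \<in> E\<close>], of c n] by (simp add: c_def norm_divide)
  qed
  ultimately have "(\<lambda>n. N (trunc (real n) x) / N x * N x) \<longlonglongrightarrow> 1 * N x"
    using cx(2) by (intro tendsto_mult_right) simp
  then show ?thesis
    using pos by simp
qed

section \<open>Disjoint summands and moving translates\<close>

text \<open>A shift by at least \<open>c\<close> keeps \<open>y\<close> disjoint from
  \<open>x\<close>, so both sums have the same level measures, hence the same rearrangement.\<close>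

lemma shift_add_closed:
  assumes xy: "x \<in> E" "y \<in> E" and xy_disj: "\<And>u. x u = 0 \<or> y u = 0"
    and x: "\<And>u. u \<notin> {0..<c} \<Longrightarrow> x u = 0" and y: "\<And>u. u \<notin> {0..<c} \<Longrightarrow> y u = 0"
    and "0 \<le> c" "c \<le> a"
  shows "(\<lambda>u. x u + shift a y u) \<in> E \<and> N (\<lambda>u. x u + shift a y u) = N (\<lambda>u. x u + y u)"
proof (rule symmetric)
  have y0: "\<And>u. u < 0 \<Longrightarrow> y u = 0" and "0 \<le> a"
    using y \<open>0 \<le> c\<close> \<open>c \<le> a\<close> by auto
  have [measurable]: "x \<in> borel_measurable half_line" "y \<in> borel_measurable half_line"
    using xy by (auto intro: measurable)
  have [measurable]: "shift a y \<in> borel_measurable half_line"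
    by (rule measurable_shift) (use y0 \<open>0 \<le> a\<close> in auto)
  show "(\<lambda>u. x u + shift a y u) \<in> borel_measurable half_line"
    by measurable
  have disj: "x u = 0 \<or> shift a y u = 0" for u
    using x[of u] y[of "u - a"] \<open>c \<le> a\<close> by (cases "u < c") (auto simp: shift_def)
  have "level_measure (\<lambda>u. x u + shift a y u) s = level_measure (\<lambda>u. x u + y u) s" if "0 \<le> s" for s
  proof -
    have "level_measure (shift a y) s = level_measure y s"
      by (rule level_measure_shift) (use y0 \<open>0 \<le> a\<close> that in auto)
    moreover have "level_measure (\<lambda>u. x u + y u) s = level_measure x s + level_measure y s"
      by (rule level_measure_add) (use xy_disj that in auto)
    moreover have "level_measure (\<lambda>u. x u + shift a y u) s = level_measure x s + level_measure (shift a y) s"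
      by (rule level_measure_add) (use disj that in auto)
    ultimately show ?thesis
      by simp
  qed
  then show "\<forall>t\<ge>0. rearrangement (\<lambda>u. x u + shift a y u) t = rearrangement (\<lambda>u. x u + y u) t"
    by (intro allI impI rearrangement_cong)
qed (rule add_closed[OF xy])

lemma norm_summand_le_bounded_support:
  assumes modulus: "Kadec_Klee_modulus E N \<epsilon> \<delta>"
    and xy: "x \<in> E" "y \<in> E" and disj: "\<And>u. x u = 0 \<or> y u = 0"
    and x: "\<And>u. u \<notin> {0..<c} \<Longrightarrow> x u = 0" and y: "\<And>u. u \<notin> {0..<c} \<Longrightarrow> y u = 0"
    and "1 \<le> c" and N_le: "N (\<lambda>u. x u + y u) \<le> 1" and "\<epsilon> < N y"
  shows "N x \<le> 1 - \<delta>"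
proof (rule ccontr)
  assume "\<not> N x \<le> 1 - \<delta>"
  \<comment> \<open>Steps of length \<open>c\<close> keep the translates mutually disjoint, the
    extra 1 moves even the first one past the support of \<open>x\<close>, and
    \<open>1 \<le> c\<close> gives \<open>a n \<ge> n\<close>, as local convergence
    requires.\<close>
  define a where "a n = (real n + 1) * c" for n
  define Y where "Y n = shift (a n) y" for n
  define X where "X n u = x u + Y n u" for n u
  have a: "real n \<le> a n" "c \<le> a n" "0 \<le> a n" for n
    using \<open>1 \<le> c\<close> mult_left_mono[of 1 c "real n"] by (auto simp: a_def algebra_simps)
  have Y0: "Y n u = 0" if "u < a n \<or> a n + c \<le> u" for n u
    using y[of "u - a n"] that by (auto simp: Y_def shift_def)
  have X: "X n \<in> E" "N (X n) = N (\<lambda>u. x u + y u)" for n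
    using shift_add_closed[OF xy disj x y _ a(2)] \<open>1 \<le> c\<close> by (auto simp: X_def[abs_def] Y_def)
  \<comment> \<open>The same lemma with zero in place of \<open>x\<close>.\<close>
  have Y: "Y n \<in> E" "N (Y n) = N y" for n
    using shift_add_closed[OF zero_mem xy(2) _ _ y _ a(2)] \<open>1 \<le> c\<close> by (auto simp: Y_def)
  have "X n u = x u" if "u < real n" for n u
    using that a(1)[of n] by (auto simp: X_def Y0)
  then have "locally_tendsto_in_measure X x"
    by (intro locally_tendsto_in_measureI)
  then obtain K where K: "\<forall>m\<ge>K. \<forall>n\<ge>K. N (\<lambda>u. X n u - X m u) \<le> \<epsilon>"
    using Kadec_Klee_modulusD[OF modulus X(1) _ xy(1)] X(2) N_le \<open>\<not> N x \<le> 1 - \<delta>\<close> by fastforce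
  have "a K + c = a (Suc K)"
    by (simp add: a_def algebra_simps)
  \<comment> \<open>The summand \<open>x\<close> cancels. Before \<open>a (Suc K)\<close> the later
    translate vanishes, and from there on \<open>Y K\<close> does.\<close>
  then have "cmod (Y K u) \<le> cmod (X K u - X (Suc K) u)" for u
    using Y0[of u K] Y0[of u "Suc K"] by (cases "u < a (Suc K)") (auto simp: X_def)
  then have "N (Y K) \<le> N (\<lambda>u. X K u - X (Suc K) u)"
    by (intro norm_mono Y diff_closed X) auto
  also have "\<dots> \<le> \<epsilon>"
    using K by simp
  finally show False
    using Y(2) \<open>\<epsilon> < N y\<close> by simp
qed

text \<open>The homogeneous form of the previous bound: divide by the norm of the sum. Disjointness
  almost everywhere becomes pointwise by changing \<open>y\<close> on a null set.\<close>

lemma norm_summand_le: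
  assumes modulus: "Kadec_Klee_modulus E N (1 / 2) \<delta>"
    and xy: "x \<in> E" "y \<in> E" and disj: "AE u in half_line. x u = 0 \<or> y u = 0"
    and x: "\<And>u. u \<notin> {0..<c} \<Longrightarrow> x u = 0" and y: "\<And>u. u \<notin> {0..<c} \<Longrightarrow> y u = 0"
    and "1 \<le> c" and large: "N (\<lambda>u. x u + y u) < 2 * N y"
  shows "N x \<le> (1 - \<delta>) * N (\<lambda>u. x u + y u)"
proof -
  have xyE: "(\<lambda>u. x u + y u) \<in> E"
    using xy add_closed by auto
  define s where "s = N (\<lambda>u. x u + y u)"
  have "N y \<le> s"
    unfolding s_def using disj by (intro norm_mono xy xyE) (auto elim!: eventually_mono)
  \<comment> \<open>If \<open>s\<close> were 0, then \<open>N y \<le> 0\<close>, against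
    \<open>large\<close>.\<close>
  then have "0 < s"
    using large norm_nonneg[OF xyE] by (auto simp: s_def)
  define b where "b = complex_of_real (1 / s)"
  have b: "cmod b = 1 / s"
    using \<open>0 < s\<close> by (simp add: b_def norm_divide)
  define y' where "y' u = (if x u = 0 then y u else 0)" for u
  have eq: "AE u in half_line. y' u = y u"
    using disj by (auto elim!: eventually_mono simp: y'_def)
  have y'E: "y' \<in> E"
  proof (rule order_ideal[OF xy(2)])
    have [measurable]: "x \<in> borel_measurable half_line" "y \<in> borel_measurable half_line"
      using xy by (auto intro: measurable)
    show "y' \<in> borel_measurable half_line"
      unfolding y'_def[abs_def] by measurable
  qed (auto simp: y'_def)
  have Ny': "N y' = N y" "N (\<lambda>u. x u + y' u) = s"
    unfolding s_def using eq by (auto intro!: norm_cong_AE xy y'E add_closed elim: eventually_mono)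
  have "N (\<lambda>u. b * x u) \<le> 1 - \<delta>"
  proof (rule norm_summand_le_bounded_support[OF modulus])
    show "N (\<lambda>u. b * x u + b * y' u) \<le> 1"
      using norm_scale[OF add_closed[OF xy(1) y'E], of b] Ny' b \<open>0 < s\<close> by (simp add: algebra_simps)
    show "1 / 2 < N (\<lambda>u. b * y' u)"
      using large \<open>0 < s\<close> unfolding norm_scale[OF y'E] b Ny' s_def[symmetric]
      by (simp add: field_simps)
    show "(\<lambda>u. b * x u) \<in> E" "(\<lambda>u. b * y' u) \<in> E"
      using xy(1) y'E by (simp_all add: scale_closed)
  qed (use x y \<open>1 \<le> c\<close> in \<open>auto simp: y'_def\<close>)
  then show ?thesis
    using norm_scale[OF xy(1), of b] b \<open>0 < s\<close> by (simp add: s_def field_simps)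
qed

section \<open>Power sums of disjoint families\<close>

lemma sum_power_norm_le_bounded_support:
  fixes x :: "'i \<Rightarrow> real \<Rightarrow> complex"
  assumes modulus: "Kadec_Klee_modulus E N (1 / 2) \<delta>"
    and q: "0 < q" "(1 / 2) ^ q + (1 - \<delta>) ^ q \<le> 1 / 2"
    and "finite I" and x: "\<And>i. i \<in> I \<Longrightarrow> x i \<in> E"
    and disj: "\<And>i j. i \<in> I \<Longrightarrow> j \<in> I \<Longrightarrow> i \<noteq> j \<Longrightarrow> AE u in half_line. x i u = 0 \<or> x j u = 0"
    and supp: "\<And>i u. i \<in> I \<Longrightarrow> u \<notin> {0..<c} \<Longrightarrow> x i u = 0" and "1 \<le> c"
  shows "(\<Sum>i\<in>I. N (x i) ^ q) \<le> 2 * N (\<lambda>u. \<Sum>i\<in>I. x i u) ^ q"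
proof -
  define F where "F A = N (\<lambda>u. \<Sum>i\<in>A. x i u)" for A
  have "(\<Sum>i\<in>I. F {i} ^ q) \<le> 2 * F I ^ q"
  proof (rule sum_power_le_of_split[OF \<open>finite I\<close> _ _ _ q])
    show "F {} = 0"
      by (simp add: F_def norm_of_zero)
    show "F A \<le> F B" if "A \<subseteq> B" "B \<subseteq> I" for A B
      unfolding F_def
    proof (rule norm_sum_mono[OF \<open>A \<subseteq> B\<close> finite_subset[OF \<open>B \<subseteq> I\<close> \<open>finite I\<close>]])
      fix i j
      assume "i \<in> B" "j \<in> B" "i \<noteq> j"
      then show "AE u in half_line. x i u = 0 \<or> x j u = 0"
        using \<open>B \<subseteq> I\<close> by (intro disj) auto
    qed (use x \<open>B \<subseteq> I\<close> in auto)
    fix A B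
    assume AB: "A \<union> B \<subseteq> I" "A \<inter> B = {}" "F (A \<union> B) < 2 * F A"
    have fin: "finite A" "finite B"
      using AB(1) \<open>finite I\<close> by (auto intro: finite_subset)
    \<comment> \<open>The sum over \<open>B\<close> comes first because
      \<open>norm_summand_le\<close> bounds the first summand when the second is large.\<close>
    have un: "(\<Sum>i\<in>A \<union> B. x i u) = (\<Sum>i\<in>B. x i u) + (\<Sum>i\<in>A. x i u)" for u
      using fin AB by (simp add: sum.union_disjoint)
    have "AE u in half_line. \<forall>i\<in>B. \<forall>j\<in>A. x i u = 0 \<or> x j u = 0"
      using fin AB disj by (intro AE_finite_allI) blast+
    then have disj': "AE u in half_line. (\<Sum>i\<in>B. x i u) = 0 \<or> (\<Sum>i\<in>A. x i u) = 0"
      by (rule eventually_mono) (metis sum.neutral)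
    have "N (\<lambda>u. \<Sum>i\<in>B. x i u) \<le> (1 - \<delta>) * N (\<lambda>u. (\<Sum>i\<in>B. x i u) + (\<Sum>i\<in>A. x i u))"
    proof (rule norm_summand_le[OF modulus _ _ disj' _ _ \<open>1 \<le> c\<close>])
      show "N (\<lambda>u. (\<Sum>i\<in>B. x i u) + (\<Sum>i\<in>A. x i u)) < 2 * N (\<lambda>u. \<Sum>i\<in>A. x i u)"
        using AB(3) by (simp add: F_def un)
    qed (use AB fin x supp in \<open>auto intro!: sum_closed sum.neutral\<close>)
    then show "F B \<le> (1 - \<delta>) * F (A \<union> B)"
      by (simp add: F_def un)
  qed
  then show ?thesis
    by (simp add: F_def)
qed

text \<open>The exponent depends only on the \<open>\<delta>\<close> for 1/2, not on the family or
  its size. The bound holds for truncations and passes to the limit.\<close>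

lemma sum_power_norm_le:
  assumes "uniform_Kadec_Klee_Huff E N"
  shows "\<exists>q>0. \<forall>(I :: 'i set) x. finite I \<longrightarrow> (\<forall>i\<in>I. x i \<in> E) \<longrightarrow>
      (\<forall>i\<in>I. \<forall>j\<in>I. i \<noteq> j \<longrightarrow> (AE u in half_line. x i u = 0 \<or> x j u = 0)) \<longrightarrow>
      (\<Sum>i\<in>I. N (x i) ^ q) \<le> 2 * N (\<lambda>u. \<Sum>i\<in>I. x i u) ^ q"
proof -
  obtain \<delta> where \<delta>: "0 < \<delta>" "\<delta> < 1" and modulus: "Kadec_Klee_modulus E N (1 / 2) \<delta>"
    using uniform_Kadec_Klee_HuffD[OF assms, of "1 / 2"] by auto
  \<comment> \<open>Both bases lie in \<open>[0, 1)\<close>, so every large enough \<open>q\<close>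
    will do.\<close>
  have "(\<lambda>q. (1 / 2) ^ q + (1 - \<delta>) ^ q) \<longlonglongrightarrow> 0 + 0"
    using \<delta> by (intro tendsto_add LIMSEQ_realpow_zero) auto
  then have "\<forall>\<^sub>F q in sequentially. (1 / 2) ^ q + (1 - \<delta>) ^ q < 1 / 2"
    by (rule order_tendstoD) simp
  then have "\<forall>\<^sub>F q in sequentially. 0 < q \<and> (1 / 2) ^ q + (1 - \<delta>) ^ q < 1 / 2"
    using eventually_gt_at_top by (rule eventually_elim2) simp
  then obtain q where q: "0 < q" "(1 / 2) ^ q + (1 - \<delta>) ^ q < 1 / 2"
    using eventually_happens'[OF sequentially_bot] by blast
  show ?thesis
  proof (intro exI[of _ q] conjI allI impI q(1))
    fix I :: "'i set" and x :: "'i \<Rightarrow> real \<Rightarrow> complex"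
    assume I: "finite I" and x: "\<forall>i\<in>I. x i \<in> E"
      and disj: "\<forall>i\<in>I. \<forall>j\<in>I. i \<noteq> j \<longrightarrow> (AE u in half_line. x i u = 0 \<or> x j u = 0)"
    have le: "(\<Sum>i\<in>I. N (trunc (real k) (x i)) ^ q) \<le> 2 * N (\<lambda>u. \<Sum>i\<in>I. x i u) ^ q" if "1 \<le> k" for k
    proof -
      have "(\<Sum>i\<in>I. N (trunc (real k) (x i)) ^ q) \<le> 2 * N (\<lambda>u. \<Sum>i\<in>I. trunc (real k) (x i) u) ^ q"
      proof (rule sum_power_norm_le_bounded_support[OF modulus q(1) _ I])
        fix i j
        assume "i \<in> I" "j \<in> I" "i \<noteq> j"
        then have "AE u in half_line. x i u = 0 \<or> x j u = 0"
          using disj by blast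
        then show "AE u in half_line. trunc (real k) (x i) u = 0 \<or> trunc (real k) (x j) u = 0"
          by (rule eventually_mono) (auto simp: trunc_def)
      next
        show "trunc (real k) (x i) u = 0" if "u \<notin> {0..<real k}" for i u
          using that by (auto simp: trunc_def)
      qed (use q that x in \<open>auto intro: trunc_closed\<close>)
      also have "(\<lambda>u. \<Sum>i\<in>I. trunc (real k) (x i) u) = trunc (real k) (\<lambda>u. \<Sum>i\<in>I. x i u)"
        by (rule ext) (auto simp: trunc_def intro!: sum.neutral)
      also have "2 * N (trunc (real k) (\<lambda>u. \<Sum>i\<in>I. x i u)) ^ q \<le> 2 * N (\<lambda>u. \<Sum>i\<in>I. x i u) ^ q"
        using I x by (intro mult_left_mono power_mono norm_trunc_le norm_nonneg trunc_closed sum_closed) auto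
      finally show ?thesis .
    qed
    \<comment> \<open>Only the left side needs the limit; on the right, truncation has already been
      removed by monotonicity of the norm.\<close>
    have "(\<lambda>k. \<Sum>i\<in>I. N (trunc (real k) (x i)) ^ q) \<longlonglongrightarrow> (\<Sum>i\<in>I. N (x i) ^ q)"
      using x by (intro tendsto_sum tendsto_power norm_trunc_tendsto[OF assms]) auto
    then show "(\<Sum>i\<in>I. N (x i) ^ q) \<le> 2 * N (\<lambda>u. \<Sum>i\<in>I. x i u) ^ q"
      using le by (intro LIMSEQ_le_const2) auto
  qed
qed

end

theorem theorem2p10:
  fixes E :: "(real \<Rightarrow> complex) set"
    and N :: "(real \<Rightarrow> complex) \<Rightarrow> real"
  assumes "symmetric_Banach_function_space E N"
    and "uniform_Kadec_Klee_Huff E N"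
  shows "\<exists>q\<ge>1. lower_estimate E N q"
proof -
  interpret symmetric_Banach_function_space E N
    by (rule assms(1))
  obtain q where q: "0 < q"
    and le: "\<forall>(I :: nat set) x. finite I \<longrightarrow> (\<forall>i\<in>I. x i \<in> E) \<longrightarrow>
      (\<forall>i\<in>I. \<forall>j\<in>I. i \<noteq> j \<longrightarrow> (AE u in half_line. x i u = 0 \<or> x j u = 0)) \<longrightarrow>
      (\<Sum>i\<in>I. N (x i) ^ q) \<le> 2 * N (\<lambda>u. \<Sum>i\<in>I. x i u) ^ q"
    using sum_power_norm_le[OF assms(2), where ?'i = nat] by blast
  \<comment> \<open>The constant is the \<open>q\<close>-th root of the factor 2 in
    \<open>le\<close>.\<close>
  have "(\<Sum>i<n. N (x i) powr real q) powr (1 / real q) \<le> 2 powr (1 / real q) * N (\<lambda>u. \<Sum>i<n. x i u)"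
    if x: "\<forall>i<n. x i \<in> E" "\<forall>i<n. \<forall>j<n. i \<noteq> j \<longrightarrow> (AE u in half_line. x i u = 0 \<or> x j u = 0)"
    for n :: nat and x
  proof -
    have S: "0 \<le> N (\<lambda>u. \<Sum>i<n. x i u)"
      using x by (intro norm_nonneg sum_closed) auto
    have "(\<Sum>i<n. N (x i) powr real q) = (\<Sum>i<n. N (x i) ^ q)"
      using x q norm_nonneg by (intro sum.cong) (auto simp: powr_realpow')
    also have "\<dots> \<le> 2 * N (\<lambda>u. \<Sum>i<n. x i u) ^ q"
      using x by (intro le[rule_format]) auto
    also have "\<dots> = 2 * N (\<lambda>u. \<Sum>i<n. x i u) powr real q"
      using S q by (simp add: powr_realpow')
    finally have "(\<Sum>i<n. N (x i) powr real q) powr (1 / real q)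
        \<le> (2 * N (\<lambda>u. \<Sum>i<n. x i u) powr real q) powr (1 / real q)"
      by (intro powr_mono2) (auto intro: sum_nonneg)
    also have "\<dots> = 2 powr (1 / real q) * N (\<lambda>u. \<Sum>i<n. x i u)"
      using S q by (simp add: powr_mult powr_powr)
    finally show ?thesis .
  qed
  then have "lower_estimate E N (real q)"
    unfolding lower_estimate_def by (intro exI[of _ "2 powr (1 / real q)"]) auto
  then show ?thesis
    using q by (intro exI[of _ "real q"]) auto
qed

end
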